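(* Let $\epsilon,\mu>0$ be real constants, $\eta=\sqrt{\mu/\epsilon}$, and let $f_{iH},f_{iE}:\mathbb{R}\to\mathbb{R}$ be real-analytic functions (in particular $C^\infty$). Let $\theta_{max}>0$ and $x_{max}>0$, and define $$H_y(x,\theta) = f_{iH}(x) + \sum_{n=0}^{\infty} \frac{\theta^{2(n+1)}}{(2(n+1))!}\, \frac{d^{2(n+1)} f_{iH}}{dx^{2(n+1)}}(x) + \frac{1}{\eta}\sum_{n=0}^{\infty} \frac{\theta^{2n+1}}{(2n+1)!}\, \frac{d^{2n+1} f_{iE}}{dx^{2n+1}}(x),$$ $$E_z(x,\theta) = f_{iE}(x) + \sum_{n=0}^{\infty} \frac{\theta^{2(n+1)}}{(2(n+1))!}\, \frac{d^{2(n+1)} f_{iE}}{dx^{2(n+1)}}(x) + \eta\sum_{n=0}^{\infty} \frac{\theta^{2n+1}}{(2n+1)!}\, \frac{d^{2n+1} f_{iH}}{dx^{2n+1}}(x).$$ Suppose that the series in these two formulas converge for all $(x,\theta)$ in the range $0\le\theta\le\theta_{max}$, $0\le|x|\le x_{max}$. Then in this range the pair $\{H_y,E_z\}$ solves the source-free one-dimensional Maxwell initial-value problem: $$\frac{\partial H_y(x,\theta)}{\partial\theta}=\frac{1}{\eta}\frac{\partial E_z(x,\theta)}{\partial x},\qquad \frac{\partial E_z(x,\theta)}{\partial\theta}=\eta\frac{\partial H_y(x,\theta)}{\partial x},$$ $$H_y(x,0)=f_{iH}(x),\qquad E_z(x,0)=f_{iE}(x).$$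
   Context: Here $x$ is the space variable and $\theta=ct$ is the rescaled time ($t$ is time, $c=1/\sqrt{\epsilon\mu}$). The functions $H_y,E_z$ are considered on the rectangle $\{(x,\theta):|x|\le x_{max},\,0\le\theta\le\theta_{max}\}$; partial derivatives at boundary points of the rectangle are understood as one-sided. *)

theory Defs
  imports "HOL-Analysis.Analysis"
begin

definition real_analytic :: "(real \<Rightarrow> real) \<Rightarrow> bool" where
  "real_analytic f \<longleftrightarrow>
    (\<forall>x. \<exists>r>0. \<exists>a :: nat \<Rightarrow> real.
       \<forall>y. \<bar>y - x\<bar> < r \<longrightarrow> (\<lambda>n. a n * (y - x) ^ n) sums f y)"

definition even_term :: "(real \<Rightarrow> real) \<Rightarrow> real \<Rightarrow> real \<Rightarrow> nat \<Rightarrow> real" where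
  "even_term f x \<theta> n = \<theta> ^ (2 * (n + 1)) / fact (2 * (n + 1)) * (deriv ^^ (2 * (n + 1))) f x"

definition odd_term :: "(real \<Rightarrow> real) \<Rightarrow> real \<Rightarrow> real \<Rightarrow> nat \<Rightarrow> real" where
  "odd_term f x \<theta> n = \<theta> ^ (2 * n + 1) / fact (2 * n + 1) * (deriv ^^ (2 * n + 1)) f x"

definition H_y :: "real \<Rightarrow> (real \<Rightarrow> real) \<Rightarrow> (real \<Rightarrow> real) \<Rightarrow> real \<Rightarrow> real \<Rightarrow> real" where
  "H_y \<eta> f_iH f_iE x \<theta> =
     f_iH x + (\<Sum>n. even_term f_iH x \<theta> n) + (1 / \<eta>) * (\<Sum>n. odd_term f_iE x \<theta> n)"

definition E_z :: "real \<Rightarrow> (real \<Rightarrow> real) \<Rightarrow> (real \<Rightarrow> real) \<Rightarrow> real \<Rightarrow> real \<Rightarrow> real" where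
  "E_z \<eta> f_iH f_iE x \<theta> =
     f_iE x + (\<Sum>n. even_term f_iE x \<theta> n) + \<eta> * (\<Sum>n. odd_term f_iH x \<theta> n)"

(* The derivatives are taken within the sides of the rectangle, so they are ordinary partial
   derivatives in the interior and one-sided ones on the boundary. For positive x_max and
   theta_max they are unique. Their existence is part of being a solution. *)
definition solves_maxwell_ivp ::
  "real \<Rightarrow> (real \<Rightarrow> real) \<Rightarrow> (real \<Rightarrow> real) \<Rightarrow> real \<Rightarrow> real \<Rightarrow>
   (real \<Rightarrow> real \<Rightarrow> real) \<Rightarrow> (real \<Rightarrow> real \<Rightarrow> real) \<Rightarrow> bool" where
  "solves_maxwell_ivp \<eta> f_iH f_iE x_max \<theta>_max H E \<longleftrightarrow>
    (\<forall>x \<in> {-x_max..x_max}. \<forall>\<theta> \<in> {0..\<theta>_max}.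
       \<exists>H\<theta> Hx E\<theta> Ex.
         ((\<lambda>s. H x s) has_real_derivative H\<theta>) (at \<theta> within {0..\<theta>_max}) \<and>
         ((\<lambda>y. H y \<theta>) has_real_derivative Hx) (at x within {-x_max..x_max}) \<and>
         ((\<lambda>s. E x s) has_real_derivative E\<theta>) (at \<theta> within {0..\<theta>_max}) \<and>
         ((\<lambda>y. E y \<theta>) has_real_derivative Ex) (at x within {-x_max..x_max}) \<and>
         H\<theta> = (1 / \<eta>) * Ex \<and> E\<theta> = \<eta> * Hx) \<and>
    (\<forall>x \<in> {-x_max..x_max}. H x 0 = f_iH x \<and> E x 0 = f_iE x)"

end

(* Fix x. Convergence of the even and the odd series says that the whole Taylor series of f at x
   converges on [-\<theta>_max, \<theta>_max]. As f is real-analytic on the line, the identity theorem forces its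
   sum at s to be f (x + s) for |s| < \<theta>_max, and Abel's limit theorem extends this to
   |s| = \<theta>_max. The even and odd parts of the series are therefore (f (x + \<theta>) \<plusminus> f (x - \<theta>)) / 2,
   so H_y and E_z are given by d'Alembert's formula, which is differentiated directly. *)
theory Submission
  imports Defs "HOL-Complex_Analysis.Cauchy_Integral_Formula"
begin

section \<open>Power series\<close>

text \<open>Abel's limit theorem by summation by parts: with \<open>c n\<close> the error of the
  \<open>n\<close>-th partial sum, the power series at \<open>r\<close> minus \<open>L\<close> is
  \<open>(1 - r) * (\<Sum>n. c n * r ^ n)\<close>. The factor \<open>1 - r\<close> kills the
  finitely many early errors as \<open>r\<close> tends to 1, and the small later errors contribute
  at most \<open>e / 2\<close>.\<close>

lemma Abel_limit_at_left_1:
  fixes b :: "nat \<Rightarrow> real"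
  assumes "b sums L"
  shows "((\<lambda>r. \<Sum>n. b n * r ^ n) \<longlongrightarrow> L) (at_left 1)"
proof (rule tendstoI)
  fix e :: real assume e: "e > 0"
  define c where "c n = (\<Sum>k\<le>n. b k) - L" for n
  have c: "c \<longlonglongrightarrow> 0"
    using assms unfolding c_def sums_def_le by (rule LIM_zero)
  then obtain N where N: "\<And>n. n \<ge> N \<Longrightarrow> \<bar>c n\<bar> < e / 2"
    using LIMSEQ_D[OF c, of "e / 2"] half_gt_zero[OF e] unfolding diff_0_right real_norm_def by blast
  define M where "M = (\<Sum>n<N. \<bar>c n\<bar>)"
  have M: "M \<ge> 0" unfolding M_def by (simp add: sum_nonneg)
  obtain K where K: "\<And>n. \<bar>c n\<bar> \<le> K"
    using BseqD[OF convergent_imp_Bseq[OF convergentI[OF c]]] unfolding real_norm_def by blast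
  have bound: "dist (\<Sum>n. b n * r ^ n) L < e" if r: "0 < r" "r < 1" "(1 - r) * M < e / 2" for r
  proof -
    have geo: "summable (\<lambda>n. r ^ n)" using r(1,2) by (simp add: summable_geometric)
    have abs_summable: "summable (\<lambda>n. \<bar>c n\<bar> * r ^ n)"
      by (rule summable_comparison_test'[OF summable_mult[OF geo, of K], of 0])
         (use r(1) K in \<open>auto simp: abs_mult intro!: mult_right_mono\<close>)
    then have summable: "summable (\<lambda>n. c n * r ^ n)"
      by - (rule summable_rabs_cancel, use r(1) in \<open>simp add: abs_mult\<close>)
    define G where "G = (\<Sum>n. c n * r ^ n)"
    have G: "(\<lambda>n. c n * r ^ n) sums G" unfolding G_def using summable by (rule summable_sums)
    \<comment> \<open>Summation by parts: consecutive \<open>c\<close> differ by a coefficient of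
      \<open>b\<close>, so the shifted series minus \<open>r\<close> times the series is the
      \<open>b\<close>-series without its first term. Restoring \<open>b 0\<close> leaves
      \<open>b 0 - c 0 = L\<close> beside \<open>(1 - r) * G\<close>.\<close>
    have "(\<lambda>n. c (Suc n) * r ^ Suc n - r * (c n * r ^ n)) sums ((G - c 0) - r * G)"
    proof (intro sums_diff sums_mult G)
      show "(\<lambda>n. c (Suc n) * r ^ Suc n) sums (G - c 0)"
        using sums_split_initial_segment[OF G, of 1] by simp
    qed
    moreover have "c (Suc n) * r ^ Suc n - r * (c n * r ^ n) = b (Suc n) * r ^ Suc n" for n
      unfolding c_def by (simp add: algebra_simps)
    ultimately have "(\<lambda>n. b (Suc n) * r ^ Suc n) sums ((G - c 0) - r * G)"
      by (simp only:)
    then have "(\<lambda>n. b n * r ^ n) sums ((G - c 0) - r * G + b 0 * r ^ 0)"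
      by (rule sums_Suc)
    then have "(\<Sum>n. b n * r ^ n) = (G - c 0) - r * G + b 0 * r ^ 0"
      by (rule sums_unique[symmetric])
    then have sum: "(\<Sum>n. b n * r ^ n) - L = (1 - r) * G"
      by (simp add: c_def algebra_simps)
    have "\<bar>G\<bar> \<le> (\<Sum>n. \<bar>c n\<bar> * r ^ n)"
      unfolding G_def using summable_rabs[of "\<lambda>n. c n * r ^ n"] abs_summable r(1)
      by (simp add: abs_mult)
    \<comment> \<open>The tail bound is extended to the full geometric series, so that its sum
      \<open>1 / (1 - r)\<close> cancels against the factor \<open>1 - r\<close>.\<close>
    also have "\<dots> \<le> (\<Sum>n. (if n < N then \<bar>c n\<bar> else 0) + e / 2 * r ^ n)"
    proof (rule suminf_le[OF _ abs_summable])
      show "summable (\<lambda>n. (if n < N then \<bar>c n\<bar> else 0) + e / 2 * r ^ n)"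
      proof (rule summable_add)
        show "summable (\<lambda>n. if n < N then \<bar>c n\<bar> else 0)"
          by (rule summable_finite[of "{..<N}"]) simp_all
        show "summable (\<lambda>n. e / 2 * r ^ n)"
          by (rule summable_mult[OF geo])
      qed
      show "\<bar>c n\<bar> * r ^ n \<le> (if n < N then \<bar>c n\<bar> else 0) + e / 2 * r ^ n" for n
      proof (cases "n < N")
        case True
        have "\<bar>c n\<bar> * r ^ n \<le> \<bar>c n\<bar>"
          using r(1,2) by (intro mult_left_le power_le_one) auto
        moreover have "0 \<le> e / 2 * r ^ n" using r(1) e by simp
        ultimately show ?thesis using True by simp
      next
        case False
        then have "\<bar>c n\<bar> \<le> e / 2" using N[of n] by simp
        then have "\<bar>c n\<bar> * r ^ n \<le> e / 2 * r ^ n"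
          by (rule mult_right_mono) (use r(1) in simp)
        with False show ?thesis by simp
      qed
    qed
    also have "\<dots> = M + e / 2 * (1 / (1 - r))"
    proof -
      have "(\<lambda>n. if n < N then \<bar>c n\<bar> else 0) sums M"
        unfolding M_def using sums_If_finite_set[of "{..<N}" "\<lambda>n. \<bar>c n\<bar>"] by simp
      moreover have "(\<lambda>n. e / 2 * r ^ n) sums (e / 2 * (1 / (1 - r)))"
        by (rule sums_mult, rule geometric_sums) (use r(1,2) in simp)
      ultimately show ?thesis by (rule sums_unique[OF sums_add, symmetric])
    qed
    finally have "(1 - r) * \<bar>G\<bar> \<le> (1 - r) * (M + e / 2 * (1 / (1 - r)))"
      using r(2) by (intro mult_left_mono) auto
    also have "\<dots> = (1 - r) * M + e / 2"
      using r(2) by (simp add: field_simps)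
    also have "\<dots> < e" using r(3) by linarith
    finally show ?thesis using r(2) by (simp add: dist_real_def sum abs_mult)
  qed
  have "((\<lambda>r. (1 - r) * M) \<longlongrightarrow> (1 - 1) * M) (at_left 1)"
    by (intro tendsto_intros)
  then have "eventually (\<lambda>r. (1 - r) * M < e / 2) (at_left 1)"
    using e by (intro order_tendstoD) auto
  moreover have "eventually (\<lambda>r. r \<in> {0<..<1}) (at_left (1::real))"
    by (rule eventually_at_left_real) simp
  ultimately show "eventually (\<lambda>r. dist (\<Sum>n. b n * r ^ n) L < e) (at_left 1)"
    by eventually_elim (use bound in auto)
qed

text \<open>Termwise differentiation expands \<open>deriv f\<close> on the same interval with
  coefficients \<open>diffs a\<close>. The induction hypothesis is applied to this pair, hence the
  generalisation over \<open>f\<close> and \<open>a\<close>.\<close>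

lemma powser_coeff_eq_higher_deriv:
  fixes f :: "real \<Rightarrow> real"
  assumes "r > 0" and "\<And>y. \<bar>y - x\<bar> < r \<Longrightarrow> (\<lambda>n. a n * (y - x) ^ n) sums f y"
  shows "a n = (deriv ^^ n) f x / fact n"
  using assms(2)
proof (induction n arbitrary: f a)
  case 0
  from 0[of x] \<open>r > 0\<close> show ?case by simp
next
  case (Suc n)
  define g where "g s = f (x + s)" for s
  have g: "(\<lambda>n. a n * s ^ n) sums g s" if "norm s < r" for s
    using Suc.prems[of "x + s"] that by (simp add: g_def)
  have deriv: "(\<lambda>n. diffs a n * (y - x) ^ n) sums deriv f y" if y: "\<bar>y - x\<bar> < r" for y
  proof -
    have "eventually (\<lambda>s. s \<in> ball 0 r) (nhds (y - x))"
      by (rule eventually_nhds_in_open) (use y in auto)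
    then have eq: "eventually (\<lambda>s. (\<Sum>n. a n * s ^ n) = g s) (nhds (y - x))"
      by eventually_elim (use g in \<open>auto simp: sums_iff\<close>)
    have "((\<lambda>s. \<Sum>n. a n * s ^ n) has_real_derivative (\<Sum>n. diffs a n * (y - x) ^ n)) (at (y - x))"
      by (rule termdiffs_strong'[where K = r]) (use y g in \<open>auto simp: sums_iff\<close>)
    then have g': "(g has_real_derivative (\<Sum>n. diffs a n * (y - x) ^ n)) (at (y - x))"
      using DERIV_cong_ev[OF refl eq refl] by simp
    moreover have "((\<lambda>s. g (s - x)) has_real_derivative (\<Sum>n. diffs a n * (y - x) ^ n)) (at y)"
      using DERIV_shift[of g _ y "- x"] g' by simp
    then have "deriv f y = (\<Sum>n. diffs a n * (y - x) ^ n)"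
      by (intro DERIV_imp_deriv) (simp add: g_def)
    ultimately show ?thesis
      using termdiffs_sums_strong[OF g g'] y by simp
  qed
  have "a (Suc n) = diffs a n / real (Suc n)" by (simp add: diffs_def)
  also have "diffs a n = (deriv ^^ n) (deriv f) x / fact n"
    using Suc.IH[OF deriv] by blast
  finally show ?case
    by (simp add: funpow_Suc_right mult.commute del: funpow.simps)
qed

text \<open>The same coefficients define a holomorphic function on the complex disc of radius
  \<open>T\<close>. Its Taylor series at \<open>s0\<close> converges on the disc of radius
  \<open>T - \<bar>s0\<bar>\<close>, and real parts give the real expansion.\<close>

lemma real_powser_recenter:
  fixes c :: "nat \<Rightarrow> real"
  assumes summable: "\<And>s. \<bar>s\<bar> < T \<Longrightarrow> summable (\<lambda>n. c n * s ^ n)" and "\<bar>s0\<bar> < T"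
  obtains r b where "r > 0"
    and "\<And>s. \<bar>s - s0\<bar> < r \<Longrightarrow> (\<lambda>n. b n * (s - s0) ^ n) sums (\<Sum>n. c n * s ^ n)"
proof -
  define F where "F z = (\<Sum>n. complex_of_real (c n) * z ^ n)" for z
  have F: "(\<lambda>n. complex_of_real (c n) * z ^ n) sums F z" if z: "norm z < T" for z
  proof -
    \<comment> \<open>The midpoint \<open>t\<close> is a real point strictly between
      \<open>norm z\<close> and \<open>T\<close>: convergence at \<open>t\<close> forces convergence
      at every complex point of smaller modulus.\<close>
    define t where "t = (norm z + T) / 2"
    have "norm z \<ge> 0" by simp
    with z have "T > 0" by (rule le_less_trans[rotated])
    with \<open>norm z \<ge> 0\<close> have "t \<ge> 0" by (simp add: t_def)
    have "norm z < t" "t < T" using z by (simp_all add: t_def)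
    with \<open>t \<ge> 0\<close> have t: "\<bar>t\<bar> < T" by simp
    have "summable (\<lambda>n. complex_of_real (c n * t ^ n))"
      by (rule summable_of_real[OF summable[OF t]])
    then have "summable (\<lambda>n. complex_of_real (c n) * of_real t ^ n)" by simp
    then have "summable (\<lambda>n. complex_of_real (c n) * z ^ n)"
      by (rule powser_inside) (use \<open>norm z < t\<close> in auto)
    then show ?thesis unfolding F_def by (rule summable_sums)
  qed
  have F_real: "Re (F (of_real s)) = (\<Sum>n. c n * s ^ n)" if "\<bar>s\<bar> < T" for s
    using sums_Re[OF F[of "of_real s"]] that by (simp add: sums_iff flip: of_real_power)
  have "F holomorphic_on ball 0 T"
    by (rule power_series_holomorphic) (use F in simp)
  then have hol: "F holomorphic_on ball (of_real s0) (T - \<bar>s0\<bar>)"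
  proof (rule holomorphic_on_subset, intro subsetI)
    fix z :: complex assume "z \<in> ball (of_real s0) (T - \<bar>s0\<bar>)"
    then have "norm (z - of_real s0) < T - \<bar>s0\<bar>" by (simp add: dist_norm norm_minus_commute)
    then show "z \<in> ball 0 T" using norm_triangle_sub[of z "of_real s0"] by simp
  qed
  \<comment> \<open>For real \<open>s\<close> the powers of \<open>s - s0\<close> are real, so
    \<open>Re\<close> passes to the coefficients; there is no need to show that the derivatives of
    \<open>F\<close> at \<open>s0\<close> are real.\<close>
  define b where "b n = Re ((deriv ^^ n) F (of_real s0) / fact n)" for n
  show thesis
  proof (rule that[of "T - \<bar>s0\<bar>" b])
    show "T - \<bar>s0\<bar> > 0" using assms by simp
    fix s assume s: "\<bar>s - s0\<bar> < T - \<bar>s0\<bar>"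
    have "(\<lambda>n. (deriv ^^ n) F (of_real s0) / fact n * (of_real s - of_real s0) ^ n) sums F (of_real s)"
      by (rule holomorphic_power_series[OF hol])
         (use s in \<open>simp add: dist_norm abs_minus_commute flip: of_real_diff\<close>)
    from sums_Re[OF this]
    have "(\<lambda>n. Re ((deriv ^^ n) F (of_real s0) / fact n * (of_real s - of_real s0) ^ n)) sums Re (F (of_real s))" .
    moreover have "Re (w * (of_real s - of_real s0) ^ n) = Re w * (s - s0) ^ n" for w n
      by (simp flip: of_real_diff of_real_power)
    ultimately have "(\<lambda>n. b n * (s - s0) ^ n) sums Re (F (of_real s))"
      unfolding b_def by (simp only:)
    then show "(\<lambda>n. b n * (s - s0) ^ n) sums (\<Sum>n. c n * s ^ n)"
      using F_real[of s] s by simp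
  qed
qed

text \<open>The set \<open>Z\<close> of points near which \<open>h\<close> vanishes identically is
  open. Every point of \<open>S\<close> outside \<open>Z\<close> has a nonzero coefficient in its
  expansion, hence a neighbourhood disjoint from \<open>Z\<close>. Connectedness of \<open>S\<close>
  then leaves no point outside \<open>Z\<close>.\<close>

lemma real_analytic_identity_theorem:
  fixes h :: "real \<Rightarrow> real"
  assumes S: "open S" "connected S"
    and powser: "\<And>s. s \<in> S \<Longrightarrow>
      \<exists>r>0. \<exists>b. \<forall>y. \<bar>y - s\<bar> < r \<longrightarrow> (\<lambda>n. b n * (y - s) ^ n) sums h y"
    and a: "a \<in> S" "eventually (\<lambda>y. h y = 0) (nhds a)"
    and "s \<in> S"
  shows "h s = 0"
proof -
  define Z where "Z = {s. eventually (\<lambda>y. h y = 0) (nhds s)}"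
  have "open Z"
  proof (subst open_subopen, rule ballI)
    fix u assume "u \<in> Z"
    then obtain N where N: "open N" "u \<in> N" "\<forall>y\<in>N. h y = 0"
      unfolding Z_def eventually_nhds by blast
    then have "N \<subseteq> Z" unfolding Z_def eventually_nhds by blast
    with N show "\<exists>N. open N \<and> u \<in> N \<and> N \<subseteq> Z" by blast
  qed
  have "\<exists>U. open U \<and> t \<in> U \<and> U \<subseteq> - Z" if t: "t \<in> S" "t \<notin> Z" for t
  proof -
    obtain r b where r: "r > 0"
      and b: "\<And>y. \<bar>y - t\<bar> < r \<Longrightarrow> (\<lambda>n. b n * (y - t) ^ n) sums h y"
      using powser[OF t(1)] by blast
    have "\<exists>m. b m \<noteq> 0"
    proof (rule ccontr)
      assume "\<not> ?thesis"
      then have "h y = 0" if "\<bar>y - t\<bar> < r" for y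
        using b[OF that] by (simp add: sums_iff)
      then have "eventually (\<lambda>y. h y = 0) (nhds t)"
        unfolding eventually_nhds_metric using r by (auto simp: dist_real_def)
      with t show False by (simp add: Z_def)
    qed
    then obtain m where m: "b m \<noteq> 0" by blast
    have "\<exists>d>0. \<forall>z. z \<noteq> t \<and> \<bar>z - t\<bar> < d \<longrightarrow> h z \<noteq> 0"
    \<comment> \<open>At a zero of \<open>h\<close> some coefficient of positive index is nonzero,
      so the zero is isolated. At any other point continuity keeps \<open>h\<close> nonzero
      nearby.\<close>
    proof (cases "h t = 0")
      case True
      with b[of t] r have "b 0 = 0" by simp
      with m have "m > 0" by (cases m) auto
      obtain s where "0 < s" "\<And>z. z \<in> cball t s - {t} \<Longrightarrow> h z \<noteq> 0"
        by (rule powser_0_nonzero[where f = h and a = b and m = m and \<xi> = t, OF r]) (use b True m \<open>m > 0\<close> in auto)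
      then show ?thesis by (intro exI[of _ s]) (auto simp: dist_real_def)
    next
      case False
      have "((\<lambda>s. h (t + s)) \<longlongrightarrow> b 0) (at 0)"
        by (rule powser_limit_0[OF r]) (use b[of "t + _"] in auto)
      moreover have "b 0 = h t" using b[of t] r by simp
      ultimately have "(h \<longlongrightarrow> h t) (at t)"
        by (simp add: LIM_offset_zero_iff[of t h])
      then have "eventually (\<lambda>z. h z \<noteq> 0) (at t)"
        using False by (rule tendsto_imp_eventually_ne)
      then show ?thesis by (auto simp: eventually_at dist_real_def)
    qed
    then obtain d where d: "d > 0" "\<And>z. z \<noteq> t \<Longrightarrow> \<bar>z - t\<bar> < d \<Longrightarrow> h z \<noteq> 0" by blast
    have "z \<notin> Z" if "\<bar>z - t\<bar> < d" for z
    proof (cases "z = t")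
      case False
      with d(2)[of z] that show ?thesis
        by (auto simp: Z_def dest: eventually_nhds_x_imp_x)
    qed (use t in simp)
    then show ?thesis
      using d(1) by (intro exI[of _ "ball t d"]) (auto simp: dist_real_def abs_minus_commute)
  qed
  then obtain U where U: "\<And>t. t \<in> S - Z \<Longrightarrow> open (U t) \<and> t \<in> U t \<and> U t \<subseteq> - Z"
    by (metis Diff_iff)
  define V where "V = (\<Union>t\<in>S - Z. U t)"
  have "open V" unfolding V_def using U by (intro open_UN) blast
  moreover have "S \<subseteq> Z \<union> V" "Z \<inter> V \<inter> S = {}"
    using U unfolding V_def by blast+
  moreover have "Z \<inter> S \<noteq> {}" using a by (auto simp: Z_def)
  ultimately have "V \<inter> S = {}"
    using connectedD[OF S(2) \<open>open Z\<close> \<open>open V\<close>] by blast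
  with \<open>S \<subseteq> Z \<union> V\<close> \<open>s \<in> S\<close> have "s \<in> Z" by blast
  then show ?thesis unfolding Z_def by (auto dest: eventually_nhds_x_imp_x)
qed

section \<open>Taylor series of real-analytic functions\<close>

text \<open>The unspecified coefficients in \<open>real_analytic\<close> are necessarily the Taylor
  coefficients.\<close>

lemma real_analytic_taylor_near:
  assumes "real_analytic f"
  obtains r where "r > 0"
    and "\<And>y. \<bar>y - x\<bar> < r \<Longrightarrow> (\<lambda>n. (deriv ^^ n) f x / fact n * (y - x) ^ n) sums f y"
proof -
  obtain r a where r: "r > 0" and a: "\<And>y. \<bar>y - x\<bar> < r \<Longrightarrow> (\<lambda>n. a n * (y - x) ^ n) sums f y"
    using assms unfolding real_analytic_def by blast
  have "a = (\<lambda>n. (deriv ^^ n) f x / fact n)"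
    using powser_coeff_eq_higher_deriv[OF r a] by blast
  with that r a show thesis by blast
qed

text \<open>The local power series is differentiated at its centre. This justifies the continuity
  step at the endpoints of the Taylor interval and the differentiation of d'Alembert's
  formula.\<close>

lemma real_analytic_has_derivative:
  assumes "real_analytic f"
  shows "(f has_real_derivative deriv f x) (at x)"
proof -
  obtain r a where r: "r > 0" and a: "\<And>y. \<bar>y - x\<bar> < r \<Longrightarrow> (\<lambda>n. a n * (y - x) ^ n) sums f y"
    using assms unfolding real_analytic_def by blast
  have f: "(\<lambda>n. a n * s ^ n) sums f (x + s)" if "norm s < r" for s
    using a[of "x + s"] that by simp
  have "((\<lambda>s. \<Sum>n. a n * s ^ n) has_real_derivative (\<Sum>n. diffs a n * 0 ^ n)) (at 0)"
    by (rule termdiffs_strong'[where K = r]) (use r f in \<open>auto simp: sums_iff\<close>)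
  then have "((\<lambda>s. f (x + s)) has_real_derivative (\<Sum>n. diffs a n * 0 ^ n)) (at 0)"
    by (rule has_field_derivative_transform_within[OF _ r])
       (use f in \<open>auto simp: sums_iff\<close>)
  then have "(f has_real_derivative (\<Sum>n. diffs a n * 0 ^ n)) (at x)"
    using DERIV_shift[of f _ 0 x] by (simp add: add.commute)
  then show ?thesis using DERIV_imp_deriv by metis
qed

text \<open>Analyticity alone equates the series with \<open>f\<close> only near \<open>x\<close>.
  The difference of the two is analytic on the open interval of radius \<open>T\<close>, so it
  vanishes there; Abel's theorem and continuity of \<open>f\<close> settle
  \<open>\<bar>s\<bar> = T\<close>.\<close>

lemma real_analytic_taylor_sums:
  assumes f: "real_analytic f"
    and summable: "\<And>s. \<bar>s\<bar> \<le> T \<Longrightarrow> summable (\<lambda>n. (deriv ^^ n) f x / fact n * s ^ n)"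
    and s: "\<bar>s\<bar> \<le> T"
  shows "(\<lambda>n. (deriv ^^ n) f x / fact n * s ^ n) sums f (x + s)"
proof -
  define c where "c n = (deriv ^^ n) f x / fact n" for n
  note summable = summable[folded c_def]
  have interior: "(\<Sum>n. c n * t ^ n) = f (x + t)" if t: "\<bar>t\<bar> < T" for t
  proof -
    define h where "h y = f (x + y) - (\<Sum>n. c n * y ^ n)" for y
    have "h t = 0"
    proof (rule real_analytic_identity_theorem[where S = "{-T<..<T}" and a = 0 and h = h])
      show "open {-T<..<T}" "connected {-T<..<T}" "0 \<in> {-T<..<T}" "t \<in> {-T<..<T}"
        using t by auto
      obtain r where r: "r > 0" "\<And>y. \<bar>y - x\<bar> < r \<Longrightarrow> (\<lambda>n. c n * (y - x) ^ n) sums f y"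
        unfolding c_def by (rule real_analytic_taylor_near[OF f, of x]) blast
      then have "h y = 0" if "\<bar>y\<bar> < r" for y
        using r(2)[of "x + y"] that by (simp add: h_def sums_iff)
      then show "eventually (\<lambda>y. h y = 0) (nhds 0)"
        unfolding eventually_nhds_metric using r by (auto simp: dist_real_def)
    next
      fix u assume u: "u \<in> {-T<..<T}"
      obtain p a where p: "p > 0"
        and a: "\<And>y. \<bar>y - (x + u)\<bar> < p \<Longrightarrow> (\<lambda>n. a n * (y - (x + u)) ^ n) sums f y"
        using f unfolding real_analytic_def by blast
      have "\<bar>u\<bar> < T" using u by auto
      then obtain q b where q: "q > 0"
        and b: "\<And>y. \<bar>y - u\<bar> < q \<Longrightarrow> (\<lambda>n. b n * (y - u) ^ n) sums (\<Sum>n. c n * y ^ n)"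
        by (rule real_powser_recenter[of T c, rotated]) (use summable in auto)
      \<comment> \<open>Near \<open>u\<close> the expansion of \<open>f\<close> about
        \<open>x + u\<close> minus the recentred Taylor series is an expansion of
        \<open>h\<close>.\<close>
      have "(\<lambda>n. (a n - b n) * (y - u) ^ n) sums h y" if "\<bar>y - u\<bar> < min p q" for y
        using sums_diff[OF a[of "x + y"] b[of y]] that by (simp add: h_def algebra_simps)
      then show "\<exists>r>0. \<exists>b. \<forall>y. \<bar>y - u\<bar> < r \<longrightarrow> (\<lambda>n. b n * (y - u) ^ n) sums h y"
        using p q by (intro exI[of _ "min p q"] conjI exI[of _ "\<lambda>n. a n - b n"]) auto
    qed
    then show ?thesis by (simp add: h_def)
  qed
  \<comment> \<open>The point \<open>s\<close> is approached along \<open>s * r\<close> with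
    \<open>r\<close> increasing to 1, which treats interior points and both endpoints alike.\<close>
  have "((\<lambda>r. \<Sum>n. c n * s ^ n * r ^ n) \<longlongrightarrow> (\<Sum>n. c n * s ^ n)) (at_left 1)"
    by (rule Abel_limit_at_left_1) (use summable[OF s] in \<open>rule summable_sums\<close>)
  moreover have "eventually (\<lambda>r. (\<Sum>n. c n * s ^ n * r ^ n) = f (x + s * r)) (at_left 1)"
  \<comment> \<open>For \<open>T = 0\<close> the open interval is empty and \<open>interior\<close>
    says nothing; then \<open>s = 0\<close> and only the constant term remains.\<close>
  proof (cases "T = 0")
    case True
    with s have "s = 0" by simp
    moreover obtain r where "r > 0" "\<And>y. \<bar>y - x\<bar> < r \<Longrightarrow> (\<lambda>n. c n * (y - x) ^ n) sums f y"
      unfolding c_def by (rule real_analytic_taylor_near[OF f, of x]) blast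
    then have "c 0 = f x" by (metis abs_zero cancel_comm_monoid_add_class.diff_cancel powser_sums_zero_iff)
    moreover have "(\<Sum>n. c n * 0 ^ n * r ^ n) = c 0" for r
      using powser_zero[of "\<lambda>n. c n * r ^ n"] by (simp only: mult_ac power_0 mult_1)
    ultimately show ?thesis by simp
  next
    case False
    with s have T: "T > 0" by linarith
    have "eventually (\<lambda>r. r \<in> {0<..<1}) (at_left (1::real))"
      by (rule eventually_at_left_real) simp
    then show ?thesis
    proof eventually_elim
      case (elim r)
      have "\<bar>s * r\<bar> \<le> T * r" using s elim by (auto simp: abs_mult intro: mult_right_mono)
      also have "\<dots> < T" using T elim by simp
      finally show ?case using interior[of "s * r"] by (simp add: power_mult_distrib mult.assoc)
    qed
  qed
  ultimately have "((\<lambda>r. f (x + s * r)) \<longlongrightarrow> (\<Sum>n. c n * s ^ n)) (at_left 1)"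
    by (simp add: tendsto_cong)
  moreover have "((\<lambda>r. f (x + s * r)) \<longlongrightarrow> f (x + s * 1)) (at_left 1)"
  proof (rule isCont_tendsto_compose[where g = f])
    show "isCont f (x + s * 1)"
      using real_analytic_has_derivative[OF f] by (rule DERIV_isCont)
  qed (intro tendsto_intros)
  ultimately have "(\<Sum>n. c n * s ^ n) = f (x + s)"
    using tendsto_unique[OF trivial_limit_at_left_real] by fastforce
  with summable[OF s] show ?thesis by (simp add: sums_iff c_def)
qed

section \<open>d'Alembert's formula and the Maxwell system\<close>

text \<open>Interleaving the even and odd series gives the Taylor series at \<open>\<theta>\<close>;
  flipping the sign of the odd part gives it at \<open>-\<theta>\<close>. Their sums are
  \<open>f (x + \<theta>)\<close> and \<open>f (x - \<theta>)\<close>, and half the sum and half the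
  difference isolate the two parts.\<close>

lemma even_odd_sums_dAlembert:
  assumes f: "real_analytic f" and \<theta>: "0 \<le> \<theta>" "\<theta> \<le> T"
    and summable: "\<And>\<theta>. 0 \<le> \<theta> \<Longrightarrow> \<theta> \<le> T \<Longrightarrow> summable (even_term f x \<theta>) \<and> summable (odd_term f x \<theta>)"
  shows "f x + (\<Sum>n. even_term f x \<theta> n) = (f (x + \<theta>) + f (x - \<theta>)) / 2"
    and "(\<Sum>n. odd_term f x \<theta> n) = (f (x + \<theta>) - f (x - \<theta>)) / 2"
proof -
  define c where "c n = (deriv ^^ n) f x / fact n" for n
  define E where "E \<theta> = (\<Sum>n. even_term f x \<theta> n)" for \<theta>
  define O' where "O' \<theta> = (\<Sum>n. odd_term f x \<theta> n)" for \<theta>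
  have even: "(\<lambda>n. c (2 * n) * \<theta> ^ (2 * n)) sums (f x + E \<theta>)"
    and odd: "(\<lambda>n. c (2 * n + 1) * \<theta> ^ (2 * n + 1)) sums O' \<theta>"
    if "0 \<le> \<theta>" "\<theta> \<le> T" for \<theta>
  proof -
    have "(\<lambda>n. c (2 * Suc n) * \<theta> ^ (2 * Suc n)) sums E \<theta>"
      using summable_sums[of "even_term f x \<theta>"] summable[OF that]
      by (simp add: E_def c_def even_term_def[abs_def] mult.commute del: funpow.simps power_Suc fact_Suc)
    \<comment> \<open>\<open>even_term\<close> starts at exponent 2; the missing constant term is
      \<open>c 0 = f x\<close>.\<close>
    then have "(\<lambda>n. c (2 * n) * \<theta> ^ (2 * n)) sums (E \<theta> + c (2 * 0) * \<theta> ^ (2 * 0))"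
      by (rule sums_Suc)
    then show "(\<lambda>n. c (2 * n) * \<theta> ^ (2 * n)) sums (f x + E \<theta>)" by (simp add: c_def add.commute)
    show "(\<lambda>n. c (2 * n + 1) * \<theta> ^ (2 * n + 1)) sums O' \<theta>"
      using summable_sums[of "odd_term f x \<theta>"] summable[OF that]
      by (simp add: O'_def c_def odd_term_def[abs_def] mult.commute del: funpow.simps power_Suc fact_Suc)
  qed
  have plus: "(\<lambda>n. c n * \<theta> ^ n) sums (f x + E \<theta> + O' \<theta>)"
    and minus: "(\<lambda>n. c n * (- \<theta>) ^ n) sums (f x + E \<theta> - O' \<theta>)"
    if "0 \<le> \<theta>" "\<theta> \<le> T" for \<theta>
  proof -
    \<comment> \<open>The conditional is the form in which \<open>sums_if\<close> interleaves two
      series.\<close>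
    have "(if even n then c (2 * (n div 2)) * \<theta> ^ (2 * (n div 2))
        else c (2 * ((n - 1) div 2) + 1) * \<theta> ^ (2 * ((n - 1) div 2) + 1)) = c n * \<theta> ^ n" for n
      by (auto elim!: oddE)
    with sums_if[OF odd[OF that] even[OF that]]
    show "(\<lambda>n. c n * \<theta> ^ n) sums (f x + E \<theta> + O' \<theta>)" by (simp only: add.commute)
    have "(if even n then c (2 * (n div 2)) * \<theta> ^ (2 * (n div 2))
        else - (c (2 * ((n - 1) div 2) + 1) * \<theta> ^ (2 * ((n - 1) div 2) + 1))) = c n * (- \<theta>) ^ n" for n
      by (auto elim!: oddE)
    with sums_if[OF sums_minus[OF odd[OF that]] even[OF that]]
    show "(\<lambda>n. c n * (- \<theta>) ^ n) sums (f x + E \<theta> - O' \<theta>)"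
      by (simp only: minus_add_cancel diff_conv_add_uminus add.commute)
  qed
  have taylor: "(\<lambda>n. c n * s ^ n) sums f (x + s)" if s: "\<bar>s\<bar> \<le> T" for s
    unfolding c_def
  proof (rule real_analytic_taylor_sums[OF f _ s], fold c_def)
    fix t :: real assume "\<bar>t\<bar> \<le> T"
    \<comment> \<open>The hypotheses cover only nonnegative arguments; a negative \<open>t\<close>
      is reached through the alternating version at \<open>\<bar>t\<bar>\<close>.\<close>
    then show "summable (\<lambda>n. c n * t ^ n)"
      using plus[of "\<bar>t\<bar>"] minus[of "\<bar>t\<bar>"] by (cases "t \<ge> 0") (auto simp: sums_iff)
  qed
  have "f (x + \<theta>) = f x + E \<theta> + O' \<theta>" "f (x - \<theta>) = f x + E \<theta> - O' \<theta>"
    using sums_unique2[OF taylor[of \<theta>] plus[OF \<theta>]] sums_unique2[OF taylor[of "-\<theta>"] minus[OF \<theta>]] \<theta>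
    by auto
  then show "f x + (\<Sum>n. even_term f x \<theta> n) = (f (x + \<theta>) + f (x - \<theta>)) / 2"
    and "(\<Sum>n. odd_term f x \<theta> n) = (f (x + \<theta>) - f (x - \<theta>)) / 2"
    by (simp_all add: E_def O'_def)
qed

theorem theorem1:
  fixes \<epsilon> \<mu> \<eta> \<theta>_max x_max :: real
    and f_iH f_iE :: "real \<Rightarrow> real"
  assumes "\<epsilon> > 0" and "\<mu> > 0" and "\<eta> = sqrt (\<mu> / \<epsilon>)"
    and "real_analytic f_iH" and "real_analytic f_iE"
    and "\<theta>_max > 0" and "x_max > 0"
    and "\<And>x \<theta>. \<lbrakk>0 \<le> \<theta>; \<theta> \<le> \<theta>_max; \<bar>x\<bar> \<le> x_max\<rbrakk> \<Longrightarrow>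
           summable (even_term f_iH x \<theta>) \<and> summable (odd_term f_iE x \<theta>) \<and>
           summable (even_term f_iE x \<theta>) \<and> summable (odd_term f_iH x \<theta>)"
  shows "solves_maxwell_ivp \<eta> f_iH f_iE x_max \<theta>_max (H_y \<eta> f_iH f_iE) (E_z \<eta> f_iH f_iE)"
proof -
  have \<eta>: "\<eta> \<noteq> 0" using assms(1-3) by simp
  \<comment> \<open>\<open>H\<close> and \<open>E\<close> are d'Alembert's formulas, differentiable
    on the whole plane in each variable; they are compared with \<open>H_y\<close> and
    \<open>E_z\<close> only on the rectangle.\<close>
  define H where "H x \<theta> = (f_iH (x + \<theta>) + f_iH (x - \<theta>)) / 2
    + (1 / \<eta>) * ((f_iE (x + \<theta>) - f_iE (x - \<theta>)) / 2)" for x \<theta>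
  define E where "E x \<theta> = (f_iE (x + \<theta>) + f_iE (x - \<theta>)) / 2
    + \<eta> * ((f_iH (x + \<theta>) - f_iH (x - \<theta>)) / 2)" for x \<theta>
  have H_eq: "H x \<theta> = H_y \<eta> f_iH f_iE x \<theta>" and E_eq: "E x \<theta> = E_z \<eta> f_iH f_iE x \<theta>"
    if x: "x \<in> {-x_max..x_max}" and \<theta>: "\<theta> \<in> {0..\<theta>_max}" for x \<theta>
  proof -
    have "\<bar>x\<bar> \<le> x_max" using x by auto
    then have sH: "summable (even_term f_iH x t) \<and> summable (odd_term f_iH x t)"
      and sE: "summable (even_term f_iE x t) \<and> summable (odd_term f_iE x t)"
      if "0 \<le> t" "t \<le> \<theta>_max" for t
      using assms(8)[of t x] that by blast+
    have \<theta>': "0 \<le> \<theta>" "\<theta> \<le> \<theta>_max" using \<theta> by auto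
    note dAlembert = even_odd_sums_dAlembert[OF assms(4) \<theta>' sH]
      even_odd_sums_dAlembert[OF assms(5) \<theta>' sE]
    show "H x \<theta> = H_y \<eta> f_iH f_iE x \<theta>" "E x \<theta> = E_z \<eta> f_iH f_iE x \<theta>"
      unfolding H_def E_def H_y_def E_z_def by (simp_all only: dAlembert)
  qed
  define DH where "DH = deriv f_iH"
  define DE where "DE = deriv f_iE"
  note derivs = DERIV_chain2[OF real_analytic_has_derivative[OF assms(4), folded DH_def]]
    DERIV_chain2[OF real_analytic_has_derivative[OF assms(5), folded DE_def]]
  define H\<theta> where "H\<theta> x \<theta> = (DH (x + \<theta>) - DH (x - \<theta>)) / 2
    + (1 / \<eta>) * ((DE (x + \<theta>) + DE (x - \<theta>)) / 2)" for x \<theta>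
  define E\<theta> where "E\<theta> x \<theta> = (DE (x + \<theta>) - DE (x - \<theta>)) / 2
    + \<eta> * ((DH (x + \<theta>) + DH (x - \<theta>)) / 2)" for x \<theta>
  \<comment> \<open>The space derivatives are expressed through the time derivatives
    \<open>H\<theta>\<close> and \<open>E\<theta>\<close>, so the Maxwell equations become
    cancellations of \<open>\<eta>\<close>.\<close>
  have derivs: "((\<lambda>s. H x s) has_real_derivative H\<theta> x \<theta>) (at \<theta> within S)"
    "((\<lambda>y. H y \<theta>) has_real_derivative E\<theta> x \<theta> / \<eta>) (at x within S)"
    "((\<lambda>s. E x s) has_real_derivative E\<theta> x \<theta>) (at \<theta> within S)"
    "((\<lambda>y. E y \<theta>) has_real_derivative \<eta> * H\<theta> x \<theta>) (at x within S)"
    for x \<theta> S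
    unfolding H_def E_def H\<theta>_def E\<theta>_def using \<eta>
    by (auto intro!: derivative_eq_intros derivs) (simp_all add: field_simps)
  show ?thesis
    unfolding solves_maxwell_ivp_def
  proof (intro conjI ballI)
    fix x \<theta> assume x: "x \<in> {-x_max..x_max}" and \<theta>: "\<theta> \<in> {0..\<theta>_max}"
    \<comment> \<open>A derivative within a side depends only on the values there. The functions
      agree on the entire side, so the radius 1 is an arbitrary choice.\<close>
    note transform = has_field_derivative_transform_within[OF _ zero_less_one]
    have "((\<lambda>s. H_y \<eta> f_iH f_iE x s) has_real_derivative H\<theta> x \<theta>) (at \<theta> within {0..\<theta>_max})"
      by (rule transform[OF derivs(1) \<theta>]) (rule H_eq[OF x])
    moreover have "((\<lambda>y. H_y \<eta> f_iH f_iE y \<theta>) has_real_derivative E\<theta> x \<theta> / \<eta>) (at x within {-x_max..x_max})"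
      by (rule transform[OF derivs(2) x]) (rule H_eq[OF _ \<theta>])
    moreover have "((\<lambda>s. E_z \<eta> f_iH f_iE x s) has_real_derivative E\<theta> x \<theta>) (at \<theta> within {0..\<theta>_max})"
      by (rule transform[OF derivs(3) \<theta>]) (rule E_eq[OF x])
    moreover have "((\<lambda>y. E_z \<eta> f_iH f_iE y \<theta>) has_real_derivative \<eta> * H\<theta> x \<theta>) (at x within {-x_max..x_max})"
      by (rule transform[OF derivs(4) x]) (rule E_eq[OF _ \<theta>])
    moreover have "H\<theta> x \<theta> = (1 / \<eta>) * (\<eta> * H\<theta> x \<theta>)" "E\<theta> x \<theta> = \<eta> * (E\<theta> x \<theta> / \<eta>)"
      using \<eta> by simp_all
    ultimately show "\<exists>H\<theta> Hx E\<theta> Ex.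
         ((\<lambda>s. H_y \<eta> f_iH f_iE x s) has_real_derivative H\<theta>) (at \<theta> within {0..\<theta>_max}) \<and>
         ((\<lambda>y. H_y \<eta> f_iH f_iE y \<theta>) has_real_derivative Hx) (at x within {-x_max..x_max}) \<and>
         ((\<lambda>s. E_z \<eta> f_iH f_iE x s) has_real_derivative E\<theta>) (at \<theta> within {0..\<theta>_max}) \<and>
         ((\<lambda>y. E_z \<eta> f_iH f_iE y \<theta>) has_real_derivative Ex) (at x within {-x_max..x_max}) \<and>
         H\<theta> = (1 / \<eta>) * Ex \<and> E\<theta> = \<eta> * Hx"
      by blast
  next
    fix x assume x: "x \<in> {-x_max..x_max}"
    show "H_y \<eta> f_iH f_iE x 0 = f_iH x" "E_z \<eta> f_iH f_iE x 0 = f_iE x"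
      \<comment> \<open>At \<open>\<theta> = 0\<close> the two shifted arguments coincide: the
        half-sums become the initial data and the half-differences vanish.\<close>
      using H_eq[OF x, of 0] E_eq[OF x, of 0] assms(6) by (simp_all add: H_def E_def)
  qed
qed

end
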